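(* For any monoidal category $\mathscr{C}$ there is a strict monoidal category that is monoidally equivalent to $\mathscr{C}$.
   Context: A monoidal category is strict if its associators and unitors are identities. A monoidal functor $F:(\mathscr{C},\otimes,I_{\mathscr{C}})\to(\mathscr{D},\bullet,I_{\mathscr{D}})$ is a functor equipped with natural isomorphisms $\Phi_{X,Y}:F(X)\bullet F(Y)\to F(X\otimes Y)$ and an isomorphism $\phi:I_{\mathscr{D}}\to F(I_{\mathscr{C}})$ satisfying the usual associativity hexagon and two unit squares (i.e. a strong monoidal functor). An equivalence of categories is a pair of functors $F:\mathscr{C}\to\mathscr{D}$, $G:\mathscr{D}\to\mathscr{C}$ together with natural isomorphisms $\eta:\mathrm{id}_{\mathscr{C}}\to G\circ F$ and $\epsilon:F\circ G\to\mathrm{id}_{\mathscr{D}}$. It is a monoidal equivalence if $F$ and $G$ are monoidal functors and $\eta,\epsilon$ are monoidal natural isomorphisms. *)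

theory Defs
  imports Main
begin

section \<open>Categories, functors and natural isomorphisms\<close>

text \<open>
  As for the structures of HOL-Algebra, a category is a record with carrier sets, and its operations
  are constrained only on these carriers.
\<close>

record ('o, 'a) category =
  Obj :: "'o set"
  Arr :: "'a set"
  Dom :: "'a \<Rightarrow> 'o"
  Cod :: "'a \<Rightarrow> 'o"
  Ident :: "'o \<Rightarrow> 'a"
  Comp :: "'a \<Rightarrow> 'a \<Rightarrow> 'a" (infixl "\<cdot>\<index>" 70)

definition Hom :: "('o, 'a, 'm) category_scheme \<Rightarrow> 'o \<Rightarrow> 'o \<Rightarrow> 'a set" where
  "Hom C X Y = {f \<in> Arr C. Dom C f = X \<and> Cod C f = Y}"

locale category =
  fixes C :: "('o, 'a, 'm) category_scheme" (structure)
  assumes Dom_in_Obj: "f \<in> Arr C \<Longrightarrow> Dom C f \<in> Obj C"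
    and Cod_in_Obj: "f \<in> Arr C \<Longrightarrow> Cod C f \<in> Obj C"
    and Ident_in_Hom: "X \<in> Obj C \<Longrightarrow> Ident C X \<in> Hom C X X"
    and Comp_in_Hom: "\<lbrakk>f \<in> Hom C X Y; g \<in> Hom C Y Z\<rbrakk> \<Longrightarrow> g \<cdot> f \<in> Hom C X Z"
    and Comp_Ident: "f \<in> Hom C X Y \<Longrightarrow> f \<cdot> Ident C X = f"
    and Ident_Comp: "f \<in> Hom C X Y \<Longrightarrow> Ident C Y \<cdot> f = f"
    and Comp_assoc:
      "\<lbrakk>f \<in> Hom C W X; g \<in> Hom C X Y; h \<in> Hom C Y Z\<rbrakk> \<Longrightarrow> (h \<cdot> g) \<cdot> f = h \<cdot> (g \<cdot> f)"

definition is_iso :: "('o, 'a, 'm) category_scheme \<Rightarrow> 'a \<Rightarrow> bool" where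
  "is_iso C f \<longleftrightarrow> f \<in> Arr C \<and>
     (\<exists>g \<in> Hom C (Cod C f) (Dom C f).
        g \<cdot>\<^bsub>C\<^esub> f = Ident C (Dom C f) \<and> f \<cdot>\<^bsub>C\<^esub> g = Ident C (Cod C f))"

definition prod_category ::
  "('o, 'a, 'm) category_scheme \<Rightarrow> ('p, 'b, 'n) category_scheme \<Rightarrow> ('o \<times> 'p, 'a \<times> 'b) category"
where
  "prod_category C D =
     \<lparr>Obj = Obj C \<times> Obj D,
      Arr = Arr C \<times> Arr D,
      Dom = (\<lambda>(f, g). (Dom C f, Dom D g)),
      Cod = (\<lambda>(f, g). (Cod C f, Cod D g)),
      Ident = (\<lambda>(X, Y). (Ident C X, Ident D Y)),
      Comp = (\<lambda>(f', g') (f, g). (f' \<cdot>\<^bsub>C\<^esub> f, g' \<cdot>\<^bsub>D\<^esub> g))\<rparr>"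

record ('o, 'a, 'p, 'b) functor_data =
  FObj :: "'o \<Rightarrow> 'p"
  FArr :: "'a \<Rightarrow> 'b"

locale cat_functor =
  C: category C + D: category D
  for C :: "('o, 'a, 'm) category_scheme"
    and D :: "('p, 'b, 'n) category_scheme" +
  fixes F :: "('o, 'a, 'p, 'b, 'f) functor_data_scheme"
  assumes FObj_in_Obj: "X \<in> Obj C \<Longrightarrow> FObj F X \<in> Obj D"
    and FArr_in_Hom: "f \<in> Hom C X Y \<Longrightarrow> FArr F f \<in> Hom D (FObj F X) (FObj F Y)"
    and FArr_Ident: "X \<in> Obj C \<Longrightarrow> FArr F (Ident C X) = Ident D (FObj F X)"
    and FArr_Comp:
      "\<lbrakk>f \<in> Hom C X Y; g \<in> Hom C Y Z\<rbrakk> \<Longrightarrow> FArr F (g \<cdot>\<^bsub>C\<^esub> f) = FArr F g \<cdot>\<^bsub>D\<^esub> FArr F f"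

definition id_functor :: "('o, 'a, 'o, 'a) functor_data" where
  "id_functor = \<lparr>FObj = (\<lambda>X. X), FArr = (\<lambda>f. f)\<rparr>"

definition comp_functor ::
  "('p, 'b, 'q, 'c, 'g) functor_data_scheme \<Rightarrow> ('o, 'a, 'p, 'b, 'f) functor_data_scheme
   \<Rightarrow> ('o, 'a, 'q, 'c) functor_data"
where
  "comp_functor G F = \<lparr>FObj = (\<lambda>X. FObj G (FObj F X)), FArr = (\<lambda>f. FArr G (FArr F f))\<rparr>"

locale natural_iso =
  F: cat_functor C D F + G: cat_functor C D G
  for C :: "('o, 'a, 'm) category_scheme"
    and D :: "('p, 'b, 'n) category_scheme"
    and F :: "('o, 'a, 'p, 'b, 'f) functor_data_scheme"
    and G :: "('o, 'a, 'p, 'b, 'g) functor_data_scheme" +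
  fixes \<eta> :: "'o \<Rightarrow> 'b"
  assumes component_in_Hom: "X \<in> Obj C \<Longrightarrow> \<eta> X \<in> Hom D (FObj F X) (FObj G X)"
    and component_iso: "X \<in> Obj C \<Longrightarrow> is_iso D (\<eta> X)"
    and naturality: "f \<in> Hom C X Y \<Longrightarrow> FArr G f \<cdot>\<^bsub>D\<^esub> \<eta> X = \<eta> Y \<cdot>\<^bsub>D\<^esub> FArr F f"


section \<open>Monoidal categories\<close>

record ('o, 'a) monoidal_category = "('o, 'a) category" +
  TensorO :: "'o \<Rightarrow> 'o \<Rightarrow> 'o" (infixl "\<otimes>\<index>" 75)
  TensorA :: "'a \<Rightarrow> 'a \<Rightarrow> 'a" (infixl "\<otimes>\<^sub>a\<index>" 75)
  Unit :: "'o"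
  Assoc :: "'o \<Rightarrow> 'o \<Rightarrow> 'o \<Rightarrow> 'a"
  LUnit :: "'o \<Rightarrow> 'a"
  RUnit :: "'o \<Rightarrow> 'a"

definition tensor_functor ::
  "('o, 'a, 'm) monoidal_category_scheme \<Rightarrow> ('o \<times> 'o, 'a \<times> 'a, 'o, 'a) functor_data"
where
  "tensor_functor C =
     \<lparr>FObj = (\<lambda>(X, Y). X \<otimes>\<^bsub>C\<^esub> Y), FArr = (\<lambda>(f, g). f \<otimes>\<^sub>a\<^bsub>C\<^esub> g)\<rparr>"

text \<open>
  The components of the associator go from \<open>(X \<otimes> Y) \<otimes> Z\<close> to \<open>X \<otimes> (Y \<otimes> Z)\<close>, those of the unitors
  from \<open>I \<otimes> X\<close> and \<open>X \<otimes> I\<close> to \<open>X\<close>. The last two assumptions are the pentagon and the triangle.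
\<close>

locale monoidal_category =
  category C
  for C :: "('o, 'a, 'm) monoidal_category_scheme" (structure) +
  assumes tensor_functor: "cat_functor (prod_category C C) C (tensor_functor C)"
    and Unit_in_Obj: "Unit C \<in> Obj C"
    and Assoc_natural_iso:
      "natural_iso (prod_category C (prod_category C C)) C
         \<lparr>FObj = (\<lambda>(X, Y, Z). (X \<otimes> Y) \<otimes> Z), FArr = (\<lambda>(f, g, h). (f \<otimes>\<^sub>a g) \<otimes>\<^sub>a h)\<rparr>
         \<lparr>FObj = (\<lambda>(X, Y, Z). X \<otimes> (Y \<otimes> Z)), FArr = (\<lambda>(f, g, h). f \<otimes>\<^sub>a (g \<otimes>\<^sub>a h))\<rparr>
         (\<lambda>(X, Y, Z). Assoc C X Y Z)"
    and LUnit_natural_iso: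
      "natural_iso C C
         \<lparr>FObj = (\<lambda>X. Unit C \<otimes> X), FArr = (\<lambda>f. Ident C (Unit C) \<otimes>\<^sub>a f)\<rparr> id_functor (LUnit C)"
    and RUnit_natural_iso:
      "natural_iso C C
         \<lparr>FObj = (\<lambda>X. X \<otimes> Unit C), FArr = (\<lambda>f. f \<otimes>\<^sub>a Ident C (Unit C))\<rparr> id_functor (RUnit C)"
    and pentagon:
      "\<lbrakk>W \<in> Obj C; X \<in> Obj C; Y \<in> Obj C; Z \<in> Obj C\<rbrakk> \<Longrightarrow>
       (Ident C W \<otimes>\<^sub>a Assoc C X Y Z) \<cdot> Assoc C W (X \<otimes> Y) Z \<cdot> (Assoc C W X Y \<otimes>\<^sub>a Ident C Z)
       = Assoc C W X (Y \<otimes> Z) \<cdot> Assoc C (W \<otimes> X) Y Z"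
    and triangle:
      "\<lbrakk>X \<in> Obj C; Y \<in> Obj C\<rbrakk> \<Longrightarrow>
       (Ident C X \<otimes>\<^sub>a LUnit C Y) \<cdot> Assoc C X (Unit C) Y = RUnit C X \<otimes>\<^sub>a Ident C Y"

text \<open>
  The equations between objects below follow from those between arrows by comparing codomains.
\<close>

locale strict_monoidal_category =
  monoidal_category C
  for C :: "('o, 'a, 'm) monoidal_category_scheme" (structure) +
  assumes tensor_assoc:
      "\<lbrakk>X \<in> Obj C; Y \<in> Obj C; Z \<in> Obj C\<rbrakk> \<Longrightarrow> (X \<otimes> Y) \<otimes> Z = X \<otimes> (Y \<otimes> Z)"
    and Unit_tensor: "X \<in> Obj C \<Longrightarrow> Unit C \<otimes> X = X"
    and tensor_Unit: "X \<in> Obj C \<Longrightarrow> X \<otimes> Unit C = X"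
    and Assoc_Ident:
      "\<lbrakk>X \<in> Obj C; Y \<in> Obj C; Z \<in> Obj C\<rbrakk> \<Longrightarrow> Assoc C X Y Z = Ident C ((X \<otimes> Y) \<otimes> Z)"
    and LUnit_Ident: "X \<in> Obj C \<Longrightarrow> LUnit C X = Ident C X"
    and RUnit_Ident: "X \<in> Obj C \<Longrightarrow> RUnit C X = Ident C X"


section \<open>Monoidal functors and monoidal equivalence\<close>

text \<open>
  \<open>FMult\<close> and \<open>FUnit\<close> are the structure isomorphisms \<open>\<Phi> X Y : F X \<bullet> F Y \<rightarrow> F (X \<otimes> Y)\<close> and
  \<open>\<phi> : I \<rightarrow> F I\<close>.
\<close>

record ('o, 'a, 'p, 'b) monoidal_functor_data = "('o, 'a, 'p, 'b) functor_data" +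
  FMult :: "'o \<Rightarrow> 'o \<Rightarrow> 'b"
  FUnit :: "'b"

locale monoidal_functor =
  C: monoidal_category C + D: monoidal_category D + cat_functor C D F
  for C :: "('o, 'a, 'm) monoidal_category_scheme"
    and D :: "('p, 'b, 'n) monoidal_category_scheme"
    and F :: "('o, 'a, 'p, 'b, 'f) monoidal_functor_data_scheme" +
  assumes FMult_natural_iso:
      "natural_iso (prod_category C C) D
         \<lparr>FObj = (\<lambda>(X, Y). FObj F X \<otimes>\<^bsub>D\<^esub> FObj F Y), FArr = (\<lambda>(f, g). FArr F f \<otimes>\<^sub>a\<^bsub>D\<^esub> FArr F g)\<rparr>
         (comp_functor F (tensor_functor C))
         (\<lambda>(X, Y). FMult F X Y)"
    and FUnit_in_Hom: "FUnit F \<in> Hom D (Unit D) (FObj F (Unit C))"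
    and FUnit_iso: "is_iso D (FUnit F)"
    and hexagon:
      "\<lbrakk>X \<in> Obj C; Y \<in> Obj C; Z \<in> Obj C\<rbrakk> \<Longrightarrow>
       FArr F (Assoc C X Y Z) \<cdot>\<^bsub>D\<^esub> FMult F (X \<otimes>\<^bsub>C\<^esub> Y) Z
         \<cdot>\<^bsub>D\<^esub> (FMult F X Y \<otimes>\<^sub>a\<^bsub>D\<^esub> Ident D (FObj F Z))
       = FMult F X (Y \<otimes>\<^bsub>C\<^esub> Z) \<cdot>\<^bsub>D\<^esub> (Ident D (FObj F X) \<otimes>\<^sub>a\<^bsub>D\<^esub> FMult F Y Z)
         \<cdot>\<^bsub>D\<^esub> Assoc D (FObj F X) (FObj F Y) (FObj F Z)"
    and left_unit_square:
      "X \<in> Obj C \<Longrightarrow>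
       FArr F (LUnit C X) \<cdot>\<^bsub>D\<^esub> FMult F (Unit C) X \<cdot>\<^bsub>D\<^esub> (FUnit F \<otimes>\<^sub>a\<^bsub>D\<^esub> Ident D (FObj F X))
       = LUnit D (FObj F X)"
    and right_unit_square:
      "X \<in> Obj C \<Longrightarrow>
       FArr F (RUnit C X) \<cdot>\<^bsub>D\<^esub> FMult F X (Unit C) \<cdot>\<^bsub>D\<^esub> (Ident D (FObj F X) \<otimes>\<^sub>a\<^bsub>D\<^esub> FUnit F)
       = RUnit D (FObj F X)"

definition id_monoidal_functor ::
  "('o, 'a, 'm) monoidal_category_scheme \<Rightarrow> ('o, 'a, 'o, 'a) monoidal_functor_data"
where
  "id_monoidal_functor C =
     \<lparr>FObj = (\<lambda>X. X), FArr = (\<lambda>f. f),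
      FMult = (\<lambda>X Y. Ident C (X \<otimes>\<^bsub>C\<^esub> Y)), FUnit = Ident C (Unit C)\<rparr>"

text \<open>The composite of \<open>F : C \<rightarrow> D\<close> and \<open>G : D \<rightarrow> E\<close>; only the target \<open>E\<close> is needed to state it.\<close>

definition comp_monoidal_functor ::
  "('q, 'c, 'm) monoidal_category_scheme
   \<Rightarrow> ('p, 'b, 'q, 'c, 'g) monoidal_functor_data_scheme
   \<Rightarrow> ('o, 'a, 'p, 'b, 'f) monoidal_functor_data_scheme
   \<Rightarrow> ('o, 'a, 'q, 'c) monoidal_functor_data"
where
  "comp_monoidal_functor E G F =
     \<lparr>FObj = (\<lambda>X. FObj G (FObj F X)), FArr = (\<lambda>f. FArr G (FArr F f)),
      FMult = (\<lambda>X Y. FArr G (FMult F X Y) \<cdot>\<^bsub>E\<^esub> FMult G (FObj F X) (FObj F Y)),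
      FUnit = FArr G (FUnit F) \<cdot>\<^bsub>E\<^esub> FUnit G\<rparr>"

locale monoidal_natural_iso =
  F: monoidal_functor C D F + G: monoidal_functor C D G + natural_iso C D F G \<eta>
  for C :: "('o, 'a, 'm) monoidal_category_scheme"
    and D :: "('p, 'b, 'n) monoidal_category_scheme"
    and F :: "('o, 'a, 'p, 'b, 'f) monoidal_functor_data_scheme"
    and G :: "('o, 'a, 'p, 'b, 'g) monoidal_functor_data_scheme"
    and \<eta> :: "'o \<Rightarrow> 'b" +
  assumes component_tensor:
      "\<lbrakk>X \<in> Obj C; Y \<in> Obj C\<rbrakk> \<Longrightarrow>
       \<eta> (X \<otimes>\<^bsub>C\<^esub> Y) \<cdot>\<^bsub>D\<^esub> FMult F X Y = FMult G X Y \<cdot>\<^bsub>D\<^esub> (\<eta> X \<otimes>\<^sub>a\<^bsub>D\<^esub> \<eta> Y)"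
    and component_Unit: "\<eta> (Unit C) \<cdot>\<^bsub>D\<^esub> FUnit F = FUnit G"

locale monoidal_equivalence =
  F: monoidal_functor C D F + G: monoidal_functor D C G +
  \<eta>: monoidal_natural_iso C C "id_monoidal_functor C" "comp_monoidal_functor C G F" \<eta> +
  \<epsilon>: monoidal_natural_iso D D "comp_monoidal_functor D F G" "id_monoidal_functor D" \<epsilon>
  for C :: "('o, 'a, 'm) monoidal_category_scheme"
    and D :: "('p, 'b, 'n) monoidal_category_scheme"
    and F :: "('o, 'a, 'p, 'b, 'f) monoidal_functor_data_scheme"
    and G :: "('p, 'b, 'o, 'a, 'g) monoidal_functor_data_scheme"
    and \<eta> :: "'o \<Rightarrow> 'a"
    and \<epsilon> :: "'p \<Rightarrow> 'b"

definition monoidally_equivalent ::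
  "('o, 'a, 'm) monoidal_category_scheme \<Rightarrow> ('p, 'b, 'n) monoidal_category_scheme \<Rightarrow> bool"
where
  "monoidally_equivalent C D \<longleftrightarrow>
     (\<exists>(F :: ('o, 'a, 'p, 'b) monoidal_functor_data) (G :: ('p, 'b, 'o, 'a) monoidal_functor_data)
        \<eta> \<epsilon>. monoidal_equivalence C D F G \<eta> \<epsilon>)"

end

theory Submission
  imports Defs
begin

text \<open>
  The objects of the strict category are the lists of objects of \<open>C\<close>, and the arrows from \<open>s\<close> to \<open>t\<close>
  are the arrows of \<open>C\<close> between the right-nested tensor products of \<open>s\<close> and \<open>t\<close>, both ending in the
  unit. Concatenation of lists is strictly associative, and the canonical isomorphisms from
  the tensor product of two such products to the product of the concatenation turn it into a
  strict tensor product; their compatibility with the associator follows by induction from the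
  pentagon, and that with the unit constraints from Kelly's consequences of the pentagon and the
  triangle. Evaluating a list is then a strong monoidal functor to \<open>C\<close>. It is fully faithful by
  construction and essentially surjective because \<open>[X]\<close> evaluates to \<open>X \<otimes> I \<cong> X\<close>. A fully faithful
  and essentially surjective monoidal functor \<open>G\<close> is part of a monoidal equivalence: all structure
  of its inverse is determined by its image under \<open>G\<close>, and all axioms can be checked there.
\<close>

section \<open>Inverses and cancellation\<close>

definition Inv :: "('o, 'a, 'm) category_scheme \<Rightarrow> 'a \<Rightarrow> 'a" where
  "Inv C f = (SOME g. g \<in> Hom C (Cod C f) (Dom C f) \<and>
     g \<cdot>\<^bsub>C\<^esub> f = Ident C (Dom C f) \<and> f \<cdot>\<^bsub>C\<^esub> g = Ident C (Cod C f))"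

text \<open>The locale axioms speak of \<open>Hom\<close>; the simp rules below use
  \<open>Arr\<close>, \<open>Dom\<close> and \<open>Cod\<close> separately, because the simplifier
  can discharge such typing conditions one by one.\<close>

lemma mem_Hom_iff: "f \<in> Hom C X Y \<longleftrightarrow> f \<in> Arr C \<and> Dom C f = X \<and> Cod C f = Y"
  by (auto simp: Hom_def)

lemma is_iso_imp_Arr: "is_iso C f \<Longrightarrow> f \<in> Arr C"
  by (simp add: is_iso_def)

context category
begin

declare Dom_in_Obj [simp] Cod_in_Obj [simp]

lemma Ident_simps [simp]:
  assumes "X \<in> Obj C"
  shows "Ident C X \<in> Arr C" "Dom C (Ident C X) = X" "Cod C (Ident C X) = X"
  using Ident_in_Hom[OF assms] by (simp_all add: mem_Hom_iff)

lemma Comp_simps [simp]: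
  assumes "f \<in> Arr C" "g \<in> Arr C" "Dom C g = Cod C f"
  shows "g \<cdot> f \<in> Arr C" "Dom C (g \<cdot> f) = Dom C f" "Cod C (g \<cdot> f) = Cod C g"
  using Comp_in_Hom[of f "Dom C f" "Cod C f" g "Cod C g"] assms by (simp_all add: mem_Hom_iff)

lemma Comp_Ident' [simp]: "\<lbrakk>f \<in> Arr C; Dom C f = X\<rbrakk> \<Longrightarrow> f \<cdot> Ident C X = f"
  using Comp_Ident[of f X "Cod C f"] by (simp add: mem_Hom_iff)

lemma Ident_Comp' [simp]: "\<lbrakk>f \<in> Arr C; Cod C f = X\<rbrakk> \<Longrightarrow> Ident C X \<cdot> f = f"
  using Ident_Comp[of f "Dom C f" X] by (simp add: mem_Hom_iff)

text \<open>As a simp rule it nests composites to the right, where a pair to be rewritten may be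
  followed by a tail. Hence the variants of later rules with one more arrow composed on the
  right.\<close>

lemma Comp_assoc' [simp]:
  "\<lbrakk>f \<in> Arr C; g \<in> Arr C; h \<in> Arr C; Dom C g = Cod C f; Dom C h = Cod C g\<rbrakk>
   \<Longrightarrow> (h \<cdot> g) \<cdot> f = h \<cdot> (g \<cdot> f)"
  using Comp_assoc[of f "Dom C f" "Cod C f" g "Cod C g" h "Cod C h"] by (simp add: mem_Hom_iff)

lemma is_isoI:
  assumes "f \<in> Arr C" "g \<in> Arr C" "Dom C g = Cod C f" "Cod C g = Dom C f"
    and "g \<cdot> f = Ident C (Dom C f)" "f \<cdot> g = Ident C (Cod C f)"
  shows "is_iso C f"
  using assms by (auto simp: is_iso_def mem_Hom_iff)

lemma Inv_simps [simp]:
  assumes "is_iso C f"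
  shows "Inv C f \<in> Arr C" "Dom C (Inv C f) = Cod C f" "Cod C (Inv C f) = Dom C f"
    and "Inv C f \<cdot> f = Ident C (Dom C f)" "f \<cdot> Inv C f = Ident C (Cod C f)"
proof -
  have "Inv C f \<in> Hom C (Cod C f) (Dom C f) \<and>
     Inv C f \<cdot> f = Ident C (Dom C f) \<and> f \<cdot> Inv C f = Ident C (Cod C f)"
    unfolding Inv_def by (rule someI_ex) (use assms in \<open>auto simp: is_iso_def\<close>)
  then show "Inv C f \<in> Arr C" "Dom C (Inv C f) = Cod C f" "Cod C (Inv C f) = Dom C f"
    "Inv C f \<cdot> f = Ident C (Dom C f)" "f \<cdot> Inv C f = Ident C (Cod C f)"
    by (simp_all add: mem_Hom_iff)
qed

lemma Inv_Comp_cancel [simp]: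
  assumes "is_iso C f" "g \<in> Arr C"
  shows "Cod C g = Dom C f \<Longrightarrow> Inv C f \<cdot> (f \<cdot> g) = g"
    and "Cod C g = Cod C f \<Longrightarrow> f \<cdot> (Inv C f \<cdot> g) = g"
  using assms is_iso_imp_Arr[OF assms(1)] by (simp_all flip: Comp_assoc')

lemma iso_cancel_left:
  assumes "is_iso C h" "f \<in> Arr C" "g \<in> Arr C" "Cod C f = Dom C h" "Cod C g = Dom C h"
    and "h \<cdot> f = h \<cdot> g"
  shows "f = g"
  using assms Inv_Comp_cancel(1) by metis

lemma iso_cancel_right:
  assumes "is_iso C h" "f \<in> Arr C" "g \<in> Arr C" "Dom C f = Cod C h" "Dom C g = Cod C h"
    and "f \<cdot> h = g \<cdot> h"
  shows "f = g"
proof -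
  note h = is_iso_imp_Arr[OF assms(1)]
  have "f = (f \<cdot> h) \<cdot> Inv C h"
    using assms(1-5) h by simp
  also have "\<dots> = g"
    unfolding assms(6) using assms(1-5) h by simp
  finally show ?thesis .
qed

text \<open>A right inverse suffices, because \<open>f\<close> is already known to be invertible and
  can be cancelled on the left.\<close>

lemma Inv_eqI:
  assumes "is_iso C f" "g \<in> Arr C" "Dom C g = Cod C f" "Cod C g = Dom C f"
    and "f \<cdot> g = Ident C (Cod C f)"
  shows "Inv C f = g"
  by (rule iso_cancel_left[OF assms(1)]) (use assms in simp_all)

lemma is_iso_Ident [simp]: "X \<in> Obj C \<Longrightarrow> is_iso C (Ident C X)"
  by (rule is_isoI[where g = "Ident C X"]) simp_all

lemma is_iso_Inv [simp]: "is_iso C f \<Longrightarrow> is_iso C (Inv C f)"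
  by (rule is_isoI[where g = f]) (simp_all add: is_iso_imp_Arr)

lemma is_iso_Comp [simp]:
  assumes "is_iso C f" "is_iso C g" "Dom C g = Cod C f"
  shows "is_iso C (g \<cdot> f)"
  by (rule is_isoI[where g = "Inv C f \<cdot> Inv C g"])
    (use assms is_iso_imp_Arr[OF assms(1)] is_iso_imp_Arr[OF assms(2)] in simp_all)

end

section \<open>Product categories and functors\<close>

lemma prod_category_simps [simp]:
  "Obj (prod_category C D) = Obj C \<times> Obj D"
  "Arr (prod_category C D) = Arr C \<times> Arr D"
  "Dom (prod_category C D) p = (Dom C (fst p), Dom D (snd p))"
  "Cod (prod_category C D) p = (Cod C (fst p), Cod D (snd p))"
  "Ident (prod_category C D) q = (Ident C (fst q), Ident D (snd q))"
  "p' \<cdot>\<^bsub>prod_category C D\<^esub> p = (fst p' \<cdot>\<^bsub>C\<^esub> fst p, snd p' \<cdot>\<^bsub>D\<^esub> snd p)"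
  by (simp_all add: prod_category_def case_prod_unfold)

lemma category_prod_category:
  assumes "category C" "category D"
  shows "category (prod_category C D)"
proof -
  interpret C: category C by fact
  interpret D: category D by fact
  show ?thesis
    by unfold_locales (auto simp: mem_Hom_iff)
qed

context cat_functor
begin

declare FObj_in_Obj [simp] FArr_Ident [simp]

lemma FArr_simps [simp]:
  assumes "f \<in> Arr C"
  shows "FArr F f \<in> Arr D" "Dom D (FArr F f) = FObj F (Dom C f)" "Cod D (FArr F f) = FObj F (Cod C f)"
  using FArr_in_Hom[of f "Dom C f" "Cod C f"] assms by (simp_all add: mem_Hom_iff)

lemma FArr_Comp' [simp]:
  "\<lbrakk>f \<in> Arr C; g \<in> Arr C; Dom C g = Cod C f\<rbrakk> \<Longrightarrow> FArr F (g \<cdot>\<^bsub>C\<^esub> f) = FArr F g \<cdot>\<^bsub>D\<^esub> FArr F f"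
  by (rule FArr_Comp) (auto simp: mem_Hom_iff)

lemma is_iso_FArr [simp]:
  assumes "is_iso C f"
  shows "is_iso D (FArr F f)"
  by (rule D.is_isoI[where g = "FArr F (Inv C f)"])
    (use assms is_iso_imp_Arr[OF assms] in \<open>simp_all flip: FArr_Comp'\<close>)

lemma FArr_Inv [simp]:
  assumes "is_iso C f"
  shows "FArr F (Inv C f) = Inv D (FArr F f)"
  by (rule D.Inv_eqI[symmetric]) (use assms is_iso_imp_Arr[OF assms] in \<open>simp_all flip: FArr_Comp'\<close>)

end

lemma cat_functorI:
  assumes "category C" "category D"
    and "\<And>X. X \<in> Obj C \<Longrightarrow> FObj F X \<in> Obj D"
    and "\<And>f. f \<in> Arr C \<Longrightarrow> FArr F f \<in> Arr D \<and> Dom D (FArr F f) = FObj F (Dom C f) \<and>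
           Cod D (FArr F f) = FObj F (Cod C f)"
    and "\<And>X. X \<in> Obj C \<Longrightarrow> FArr F (Ident C X) = Ident D (FObj F X)"
    and "\<And>f g. \<lbrakk>f \<in> Arr C; g \<in> Arr C; Dom C g = Cod C f\<rbrakk>
           \<Longrightarrow> FArr F (g \<cdot>\<^bsub>C\<^esub> f) = FArr F g \<cdot>\<^bsub>D\<^esub> FArr F f"
  shows "cat_functor C D F"
  using assms by (auto simp: cat_functor_def cat_functor_axioms_def mem_Hom_iff)

lemma natural_isoI:
  assumes "cat_functor C D F" "cat_functor C D G"
    and "\<And>X. X \<in> Obj C \<Longrightarrow> is_iso D (\<eta> X) \<and> Dom D (\<eta> X) = FObj F X \<and> Cod D (\<eta> X) = FObj G X"
    and "\<And>f. f \<in> Arr C \<Longrightarrow> FArr G f \<cdot>\<^bsub>D\<^esub> \<eta> (Dom C f) = \<eta> (Cod C f) \<cdot>\<^bsub>D\<^esub> FArr F f"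
  shows "natural_iso C D F G \<eta>"
  using assms by (auto simp: natural_iso_def natural_iso_axioms_def mem_Hom_iff is_iso_imp_Arr)

lemma natural_iso_component:
  assumes "natural_iso C D F G \<eta>" "X \<in> Obj C"
  shows "is_iso D (\<eta> X)" "\<eta> X \<in> Arr D" "Dom D (\<eta> X) = FObj F X" "Cod D (\<eta> X) = FObj G X"
  using natural_iso.component_in_Hom[OF assms] natural_iso.component_iso[OF assms]
  by (simp_all add: mem_Hom_iff)

lemma natural_iso_square:
  assumes "natural_iso C D F G \<eta>" "f \<in> Arr C"
  shows "FArr G f \<cdot>\<^bsub>D\<^esub> \<eta> (Dom C f) = \<eta> (Cod C f) \<cdot>\<^bsub>D\<^esub> FArr F f"
  by (rule natural_iso.naturality[OF assms(1)]) (use assms in \<open>simp add: mem_Hom_iff\<close>)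

section \<open>Coherence in a monoidal category\<close>

context monoidal_category
begin

declare Unit_in_Obj [simp]

lemma TensorO_in_Obj [simp]: "\<lbrakk>X \<in> Obj C; Y \<in> Obj C\<rbrakk> \<Longrightarrow> X \<otimes> Y \<in> Obj C"
  using cat_functor.FObj_in_Obj[OF tensor_functor, of "(X, Y)"] by (simp add: tensor_functor_def)

lemma TensorA_simps [simp]:
  assumes "f \<in> Arr C" "g \<in> Arr C"
  shows "f \<otimes>\<^sub>a g \<in> Arr C" "Dom C (f \<otimes>\<^sub>a g) = Dom C f \<otimes> Dom C g"
    "Cod C (f \<otimes>\<^sub>a g) = Cod C f \<otimes> Cod C g"
  using cat_functor.FArr_simps[OF tensor_functor, of "(f, g)"] assms
  by (simp_all add: tensor_functor_def)

lemma Ident_TensorA_Ident [simp]: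
  "\<lbrakk>X \<in> Obj C; Y \<in> Obj C\<rbrakk> \<Longrightarrow> Ident C X \<otimes>\<^sub>a Ident C Y = Ident C (X \<otimes> Y)"
  using cat_functor.FArr_Ident[OF tensor_functor, of "(X, Y)"] by (simp add: tensor_functor_def)

lemma interchange [simp]:
  assumes "f \<in> Arr C" "g \<in> Arr C" "f' \<in> Arr C" "g' \<in> Arr C" "Dom C f' = Cod C f" "Dom C g' = Cod C g"
  shows "(f' \<otimes>\<^sub>a g') \<cdot> (f \<otimes>\<^sub>a g) = (f' \<cdot> f) \<otimes>\<^sub>a (g' \<cdot> g)"
  using cat_functor.FArr_Comp'[OF tensor_functor, of "(f, g)" "(f', g')"] assms
  by (simp add: tensor_functor_def)

lemma interchange_Comp [simp]:
  assumes "f \<in> Arr C" "g \<in> Arr C" "f' \<in> Arr C" "g' \<in> Arr C" "Dom C f' = Cod C f" "Dom C g' = Cod C g"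
    and "h \<in> Arr C" "Cod C h = Dom C f \<otimes> Dom C g"
  shows "(f' \<otimes>\<^sub>a g') \<cdot> ((f \<otimes>\<^sub>a g) \<cdot> h) = ((f' \<cdot> f) \<otimes>\<^sub>a (g' \<cdot> g)) \<cdot> h"
proof -
  have "(f' \<otimes>\<^sub>a g') \<cdot> ((f \<otimes>\<^sub>a g) \<cdot> h) = ((f' \<otimes>\<^sub>a g') \<cdot> (f \<otimes>\<^sub>a g)) \<cdot> h"
    by (subst Comp_assoc') (use assms in simp_all)
  then show ?thesis
    using assms by simp
qed

lemma is_iso_TensorA [simp]:
  assumes "is_iso C f" "is_iso C g"
  shows "is_iso C (f \<otimes>\<^sub>a g)"
  by (rule is_isoI[where g = "Inv C f \<otimes>\<^sub>a Inv C g"])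
    (use assms is_iso_imp_Arr[OF assms(1)] is_iso_imp_Arr[OF assms(2)] in simp_all)

lemma Assoc_simps [simp]:
  assumes "X \<in> Obj C" "Y \<in> Obj C" "Z \<in> Obj C"
  shows "is_iso C (Assoc C X Y Z)" "Assoc C X Y Z \<in> Arr C"
    "Dom C (Assoc C X Y Z) = (X \<otimes> Y) \<otimes> Z" "Cod C (Assoc C X Y Z) = X \<otimes> (Y \<otimes> Z)"
  using natural_iso_component[OF Assoc_natural_iso, of "(X, Y, Z)"] assms by simp_all

lemma LUnit_simps [simp]:
  assumes "X \<in> Obj C"
  shows "is_iso C (LUnit C X)" "LUnit C X \<in> Arr C"
    "Dom C (LUnit C X) = Unit C \<otimes> X" "Cod C (LUnit C X) = X"
  using natural_iso_component[OF LUnit_natural_iso assms] by (simp_all add: id_functor_def)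

lemma RUnit_simps [simp]:
  assumes "X \<in> Obj C"
  shows "is_iso C (RUnit C X)" "RUnit C X \<in> Arr C"
    "Dom C (RUnit C X) = X \<otimes> Unit C" "Cod C (RUnit C X) = X"
  using natural_iso_component[OF RUnit_natural_iso assms] by (simp_all add: id_functor_def)

text \<open>Used from left to right, this moves associators to the left past tensor products of
  arrows. \<open>X\<close>, \<open>Y\<close>, \<open>Z\<close> are tied to the domains by premises
  so that the rule also matches objects not written as \<open>Dom C f\<close>.\<close>

lemma Assoc_naturality [simp]:
  assumes "f \<in> Arr C" "g \<in> Arr C" "h \<in> Arr C" "Dom C f = X" "Dom C g = Y" "Dom C h = Z"
  shows "(f \<otimes>\<^sub>a (g \<otimes>\<^sub>a h)) \<cdot> Assoc C X Y Z
         = Assoc C (Cod C f) (Cod C g) (Cod C h) \<cdot> ((f \<otimes>\<^sub>a g) \<otimes>\<^sub>a h)"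
  using natural_iso_square[OF Assoc_natural_iso, of "(f, g, h)"] assms by simp

lemma Assoc_naturality_Comp [simp]:
  assumes "f \<in> Arr C" "g \<in> Arr C" "h \<in> Arr C" "Dom C f = X" "Dom C g = Y" "Dom C h = Z"
    and "k \<in> Arr C" "Cod C k = (X \<otimes> Y) \<otimes> Z"
  shows "(f \<otimes>\<^sub>a (g \<otimes>\<^sub>a h)) \<cdot> (Assoc C X Y Z \<cdot> k)
         = Assoc C (Cod C f) (Cod C g) (Cod C h) \<cdot> (((f \<otimes>\<^sub>a g) \<otimes>\<^sub>a h) \<cdot> k)"
proof -
  have [simp]: "X \<in> Obj C" "Y \<in> Obj C" "Z \<in> Obj C"
    using assms by auto
  have "(f \<otimes>\<^sub>a (g \<otimes>\<^sub>a h)) \<cdot> (Assoc C X Y Z \<cdot> k) = ((f \<otimes>\<^sub>a (g \<otimes>\<^sub>a h)) \<cdot> Assoc C X Y Z) \<cdot> k"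
    by (subst Comp_assoc') (use assms in simp_all)
  also have "\<dots> = (Assoc C (Cod C f) (Cod C g) (Cod C h) \<cdot> ((f \<otimes>\<^sub>a g) \<otimes>\<^sub>a h)) \<cdot> k"
    using assms by (subst Assoc_naturality) simp_all
  also have "\<dots> = Assoc C (Cod C f) (Cod C g) (Cod C h) \<cdot> (((f \<otimes>\<^sub>a g) \<otimes>\<^sub>a h) \<cdot> k)"
    by (subst Comp_assoc') (use assms in simp_all)
  finally show ?thesis .
qed

lemma LUnit_naturality:
  "f \<in> Arr C \<Longrightarrow> f \<cdot> LUnit C (Dom C f) = LUnit C (Cod C f) \<cdot> (Ident C (Unit C) \<otimes>\<^sub>a f)"
  using natural_iso_square[OF LUnit_natural_iso] by (simp add: id_functor_def)

lemma RUnit_naturality: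
  "f \<in> Arr C \<Longrightarrow> f \<cdot> RUnit C (Dom C f) = RUnit C (Cod C f) \<cdot> (f \<otimes>\<^sub>a Ident C (Unit C))"
  using natural_iso_square[OF RUnit_natural_iso] by (simp add: id_functor_def)

text \<open>Factor the tensor product into \<open>g\<close> on the unit side followed by
  \<open>f\<close>, then slide \<open>f\<close> through the unitor by naturality. The unit squares
  of the weak inverse need this form.\<close>

lemma LUnit_TensorA:
  assumes "f \<in> Arr C" "g \<in> Arr C" "Cod C g = Unit C" "h \<in> Arr C" "Cod C h = Dom C g \<otimes> Dom C f"
  shows "LUnit C (Cod C f) \<cdot> ((g \<otimes>\<^sub>a f) \<cdot> h)
         = f \<cdot> (LUnit C (Dom C f) \<cdot> ((g \<otimes>\<^sub>a Ident C (Dom C f)) \<cdot> h))"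
proof -
  have "LUnit C (Cod C f) \<cdot> ((g \<otimes>\<^sub>a f) \<cdot> h)
      = (LUnit C (Cod C f) \<cdot> (Ident C (Unit C) \<otimes>\<^sub>a f)) \<cdot> ((g \<otimes>\<^sub>a Ident C (Dom C f)) \<cdot> h)"
    using assms by simp
  also have "\<dots> = (f \<cdot> LUnit C (Dom C f)) \<cdot> ((g \<otimes>\<^sub>a Ident C (Dom C f)) \<cdot> h)"
    using assms by (subst LUnit_naturality) simp_all
  also have "\<dots> = f \<cdot> (LUnit C (Dom C f) \<cdot> ((g \<otimes>\<^sub>a Ident C (Dom C f)) \<cdot> h))"
    by (rule Comp_assoc') (use assms in simp_all)
  finally show ?thesis .
qed

lemma RUnit_TensorA:
  assumes "f \<in> Arr C" "g \<in> Arr C" "Cod C g = Unit C" "h \<in> Arr C" "Cod C h = Dom C f \<otimes> Dom C g"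
  shows "RUnit C (Cod C f) \<cdot> ((f \<otimes>\<^sub>a g) \<cdot> h)
         = f \<cdot> (RUnit C (Dom C f) \<cdot> ((Ident C (Dom C f) \<otimes>\<^sub>a g) \<cdot> h))"
proof -
  have "RUnit C (Cod C f) \<cdot> ((f \<otimes>\<^sub>a g) \<cdot> h)
      = (RUnit C (Cod C f) \<cdot> (f \<otimes>\<^sub>a Ident C (Unit C))) \<cdot> ((Ident C (Dom C f) \<otimes>\<^sub>a g) \<cdot> h)"
    using assms by simp
  also have "\<dots> = (f \<cdot> RUnit C (Dom C f)) \<cdot> ((Ident C (Dom C f) \<otimes>\<^sub>a g) \<cdot> h)"
    using assms by (subst RUnit_naturality) simp_all
  also have "\<dots> = f \<cdot> (RUnit C (Dom C f) \<cdot> ((Ident C (Dom C f) \<otimes>\<^sub>a g) \<cdot> h))"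
    by (rule Comp_assoc') (use assms in simp_all)
  finally show ?thesis .
qed

text \<open>Tensoring with the unit is faithful: naturality of the unitor recovers \<open>f\<close>
  from the tensored arrow, since the unitor can be cancelled.\<close>

lemma Unit_TensorA_cancel:
  assumes "f \<in> Arr C" "g \<in> Arr C" "Dom C f = Dom C g" "Cod C f = Cod C g"
    and "Ident C (Unit C) \<otimes>\<^sub>a f = Ident C (Unit C) \<otimes>\<^sub>a g"
  shows "f = g"
  by (rule iso_cancel_right[of "LUnit C (Dom C f)"])
    (use assms LUnit_naturality[of f] LUnit_naturality[of g] in simp_all)

lemma TensorA_Unit_cancel:
  assumes "f \<in> Arr C" "g \<in> Arr C" "Dom C f = Dom C g" "Cod C f = Cod C g"
    and "f \<otimes>\<^sub>a Ident C (Unit C) = g \<otimes>\<^sub>a Ident C (Unit C)"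
  shows "f = g"
  by (rule iso_cancel_right[of "RUnit C (Dom C f)"])
    (use assms RUnit_naturality[of f] RUnit_naturality[of g] in simp_all)

section \<open>Kelly's coherence laws for the unit constraints\<close>

text \<open>After tensoring with the unit on the left, this follows from the pentagon for I, I, X, Y
  and two triangles, with naturality of the associator in between.\<close>

lemma LUnit_TensorO:
  assumes [simp]: "X \<in> Obj C" "Y \<in> Obj C"
  shows "LUnit C (X \<otimes> Y) \<cdot> Assoc C (Unit C) X Y = LUnit C X \<otimes>\<^sub>a Ident C Y"
proof (rule Unit_TensorA_cancel)
  let ?I = "Unit C" and ?i = "Ident C (Unit C)"
  \<comment> \<open>Composing with this isomorphism completes the longer side of the pentagon; it is
    cancelled at the end.\<close>
  let ?h = "Assoc C ?I (?I \<otimes> X) Y \<cdot> (Assoc C ?I ?I X \<otimes>\<^sub>a Ident C Y)"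
  have "(?i \<otimes>\<^sub>a (LUnit C (X \<otimes> Y) \<cdot> Assoc C ?I X Y)) \<cdot> ?h
      = (?i \<otimes>\<^sub>a LUnit C (X \<otimes> Y)) \<cdot>
        ((?i \<otimes>\<^sub>a Assoc C ?I X Y) \<cdot> Assoc C ?I (?I \<otimes> X) Y \<cdot> (Assoc C ?I ?I X \<otimes>\<^sub>a Ident C Y))"
    by simp
  also have "\<dots> = ((?i \<otimes>\<^sub>a LUnit C (X \<otimes> Y)) \<cdot> Assoc C ?I ?I (X \<otimes> Y)) \<cdot> Assoc C (?I \<otimes> ?I) X Y"
    by (subst pentagon) simp_all
  also have "\<dots> = (RUnit C ?I \<otimes>\<^sub>a (Ident C X \<otimes>\<^sub>a Ident C Y)) \<cdot> Assoc C (?I \<otimes> ?I) X Y"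
    by (subst triangle) simp_all
  also have "\<dots> = Assoc C ?I X Y \<cdot> ((RUnit C ?I \<otimes>\<^sub>a Ident C X) \<otimes>\<^sub>a Ident C Y)"
    by (subst Assoc_naturality) simp_all
  also have "\<dots> = Assoc C ?I X Y \<cdot> (((?i \<otimes>\<^sub>a LUnit C X) \<cdot> Assoc C ?I ?I X) \<otimes>\<^sub>a Ident C Y)"
    by (subst triangle) simp_all
  also have "\<dots> = (?i \<otimes>\<^sub>a (LUnit C X \<otimes>\<^sub>a Ident C Y)) \<cdot> ?h"
    by simp
  finally show "?i \<otimes>\<^sub>a (LUnit C (X \<otimes> Y) \<cdot> Assoc C ?I X Y) = ?i \<otimes>\<^sub>a (LUnit C X \<otimes>\<^sub>a Ident C Y)"
    by (rule iso_cancel_right[rotated -1]) simp_all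
qed simp_all

text \<open>The mirror image: tensor with the unit on the right and use the pentagon for X, Y, I, I
  with the triangles at Y, I and at X \<otimes> Y, I.\<close>

lemma RUnit_TensorO:
  assumes [simp]: "X \<in> Obj C" "Y \<in> Obj C"
  shows "(Ident C X \<otimes>\<^sub>a RUnit C Y) \<cdot> Assoc C X Y (Unit C) = RUnit C (X \<otimes> Y)"
proof (rule TensorA_Unit_cancel)
  let ?I = "Unit C" and ?i = "Ident C (Unit C)"
  have "Assoc C X Y ?I \<cdot> (((Ident C X \<otimes>\<^sub>a RUnit C Y) \<cdot> Assoc C X Y ?I) \<otimes>\<^sub>a ?i)
      = (Ident C X \<otimes>\<^sub>a (RUnit C Y \<otimes>\<^sub>a ?i)) \<cdot> Assoc C X (Y \<otimes> ?I) ?I \<cdot> (Assoc C X Y ?I \<otimes>\<^sub>a ?i)"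
    by simp
  also have "\<dots> = (Ident C X \<otimes>\<^sub>a ((Ident C Y \<otimes>\<^sub>a LUnit C ?I) \<cdot> Assoc C Y ?I ?I)) \<cdot> Assoc C X (Y \<otimes> ?I) ?I
        \<cdot> (Assoc C X Y ?I \<otimes>\<^sub>a ?i)"
    by (subst triangle) simp_all
  also have "\<dots> = (Ident C X \<otimes>\<^sub>a (Ident C Y \<otimes>\<^sub>a LUnit C ?I)) \<cdot>
      ((Ident C X \<otimes>\<^sub>a Assoc C Y ?I ?I) \<cdot> Assoc C X (Y \<otimes> ?I) ?I \<cdot> (Assoc C X Y ?I \<otimes>\<^sub>a ?i))"
    by simp
  also have "\<dots> = (Ident C X \<otimes>\<^sub>a (Ident C Y \<otimes>\<^sub>a LUnit C ?I)) \<cdot> (Assoc C X Y (?I \<otimes> ?I) \<cdot> Assoc C (X \<otimes> Y) ?I ?I)"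
    by (subst pentagon) simp_all
  also have "\<dots> = Assoc C X Y ?I \<cdot> ((Ident C (X \<otimes> Y) \<otimes>\<^sub>a LUnit C ?I) \<cdot> Assoc C (X \<otimes> Y) ?I ?I)"
    by simp
  also have "\<dots> = Assoc C X Y ?I \<cdot> (RUnit C (X \<otimes> Y) \<otimes>\<^sub>a ?i)"
    by (subst triangle) simp_all
  finally show "((Ident C X \<otimes>\<^sub>a RUnit C Y) \<cdot> Assoc C X Y ?I) \<otimes>\<^sub>a ?i = RUnit C (X \<otimes> Y) \<otimes>\<^sub>a ?i"
    by (rule iso_cancel_left[rotated -1]) simp_all
qed simp_all

text \<open>Naturality of the left unitor at its own component at I shows that its component at I
  \<otimes> I is that component tensored with I on the left. The law for the left unitor of a
  product and the triangle then agree.\<close>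

lemma LUnit_Unit: "LUnit C (Unit C) = RUnit C (Unit C)"
proof (rule TensorA_Unit_cancel)
  let ?I = "Unit C" and ?i = "Ident C (Unit C)"
  have "LUnit C (?I \<otimes> ?I) = ?i \<otimes>\<^sub>a LUnit C ?I"
    by (rule iso_cancel_left[of "LUnit C ?I"])
      (use LUnit_naturality[of "LUnit C ?I"] in simp_all)
  then show "LUnit C ?I \<otimes>\<^sub>a ?i = RUnit C ?I \<otimes>\<^sub>a ?i"
    using LUnit_TensorO[of ?I ?I] triangle[of ?I ?I] by simp
qed simp_all

end

section \<open>Monoidal functors\<close>

context monoidal_functor
begin

lemma FMult_simps [simp]:
  assumes "X \<in> Obj C" "Y \<in> Obj C"
  shows "is_iso D (FMult F X Y)" "FMult F X Y \<in> Arr D"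
    "Dom D (FMult F X Y) = FObj F X \<otimes>\<^bsub>D\<^esub> FObj F Y"
    "Cod D (FMult F X Y) = FObj F (X \<otimes>\<^bsub>C\<^esub> Y)"
  using natural_iso_component[OF FMult_natural_iso, of "(X, Y)"] assms
  by (simp_all add: comp_functor_def tensor_functor_def)

lemma FUnit_simps [simp]:
  "is_iso D (FUnit F)" "FUnit F \<in> Arr D" "Dom D (FUnit F) = Unit D" "Cod D (FUnit F) = FObj F (Unit C)"
  using FUnit_in_Hom FUnit_iso by (simp_all add: mem_Hom_iff)

text \<open>Naturality of \<open>FMult\<close>, solved for the image of a tensor product. The next
  three rules solve the hexagon and the unit squares likewise, so the simplifier expresses
  \<open>F\<close> on the monoidal structure of \<open>C\<close> by that of \<open>D\<close>, and
  checking axioms becomes cancelling inverses.\<close>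

lemma FArr_TensorA [simp]:
  assumes "f \<in> Arr C" "g \<in> Arr C"
  shows "FArr F (f \<otimes>\<^sub>a\<^bsub>C\<^esub> g) = FMult F (Cod C f) (Cod C g) \<cdot>\<^bsub>D\<^esub>
    ((FArr F f \<otimes>\<^sub>a\<^bsub>D\<^esub> FArr F g) \<cdot>\<^bsub>D\<^esub> Inv D (FMult F (Dom C f) (Dom C g)))"
proof (rule D.iso_cancel_right[of "FMult F (Dom C f) (Dom C g)"])
  show "FArr F (f \<otimes>\<^sub>a\<^bsub>C\<^esub> g) \<cdot>\<^bsub>D\<^esub> FMult F (Dom C f) (Dom C g)
    = (FMult F (Cod C f) (Cod C g) \<cdot>\<^bsub>D\<^esub>
    ((FArr F f \<otimes>\<^sub>a\<^bsub>D\<^esub> FArr F g) \<cdot>\<^bsub>D\<^esub> Inv D (FMult F (Dom C f) (Dom C g))))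
      \<cdot>\<^bsub>D\<^esub> FMult F (Dom C f) (Dom C g)"
    using natural_iso_square[OF FMult_natural_iso, of "(f, g)"] assms
    by (simp add: comp_functor_def tensor_functor_def)
qed (use assms in simp_all)

lemma FArr_Assoc [simp]:
  assumes [simp]: "X \<in> Obj C" "Y \<in> Obj C" "Z \<in> Obj C"
  shows "FArr F (Assoc C X Y Z) = FMult F X (Y \<otimes>\<^bsub>C\<^esub> Z) \<cdot>\<^bsub>D\<^esub>
    ((Ident D (FObj F X) \<otimes>\<^sub>a\<^bsub>D\<^esub> FMult F Y Z) \<cdot>\<^bsub>D\<^esub> (Assoc D (FObj F X) (FObj F Y) (FObj F Z) \<cdot>\<^bsub>D\<^esub>
    ((Inv D (FMult F X Y) \<otimes>\<^sub>a\<^bsub>D\<^esub> Ident D (FObj F Z)) \<cdot>\<^bsub>D\<^esub> Inv D (FMult F (X \<otimes>\<^bsub>C\<^esub> Y) Z))))"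
  by (rule D.iso_cancel_right[of "FMult F (X \<otimes>\<^bsub>C\<^esub> Y) Z
        \<cdot>\<^bsub>D\<^esub> (FMult F X Y \<otimes>\<^sub>a\<^bsub>D\<^esub> Ident D (FObj F Z))"])
    (use hexagon[of X Y Z] in simp_all)

lemma FArr_LUnit [simp]:
  assumes [simp]: "X \<in> Obj C"
  shows "FArr F (LUnit C X) = LUnit D (FObj F X) \<cdot>\<^bsub>D\<^esub>
    ((Inv D (FUnit F) \<otimes>\<^sub>a\<^bsub>D\<^esub> Ident D (FObj F X)) \<cdot>\<^bsub>D\<^esub> Inv D (FMult F (Unit C) X))"
  by (rule D.iso_cancel_right[of "FMult F (Unit C) X \<cdot>\<^bsub>D\<^esub> (FUnit F \<otimes>\<^sub>a\<^bsub>D\<^esub> Ident D (FObj F X))"])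
    (use left_unit_square[of X] in simp_all)

lemma FArr_RUnit [simp]:
  assumes [simp]: "X \<in> Obj C"
  shows "FArr F (RUnit C X) = RUnit D (FObj F X) \<cdot>\<^bsub>D\<^esub>
    ((Ident D (FObj F X) \<otimes>\<^sub>a\<^bsub>D\<^esub> Inv D (FUnit F)) \<cdot>\<^bsub>D\<^esub> Inv D (FMult F X (Unit C)))"
  by (rule D.iso_cancel_right[of "FMult F X (Unit C) \<cdot>\<^bsub>D\<^esub> (Ident D (FObj F X) \<otimes>\<^sub>a\<^bsub>D\<^esub> FUnit F)"])
    (use right_unit_square[of X] in simp_all)

end

lemma monoidal_functorI:
  fixes C :: "('o, 'a, 'm) monoidal_category_scheme"
    and D :: "('p, 'b, 'n) monoidal_category_scheme"
  assumes C: "monoidal_category C" and D: "monoidal_category D" and F: "cat_functor C D F"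
    and FMult: "\<And>X Y. \<lbrakk>X \<in> Obj C; Y \<in> Obj C\<rbrakk> \<Longrightarrow> is_iso D (FMult F X Y) \<and>
      Dom D (FMult F X Y) = FObj F X \<otimes>\<^bsub>D\<^esub> FObj F Y \<and> Cod D (FMult F X Y) = FObj F (X \<otimes>\<^bsub>C\<^esub> Y)"
    and nat: "\<And>f g. \<lbrakk>f \<in> Arr C; g \<in> Arr C\<rbrakk> \<Longrightarrow>
      FArr F (f \<otimes>\<^sub>a\<^bsub>C\<^esub> g) \<cdot>\<^bsub>D\<^esub> FMult F (Dom C f) (Dom C g)
      = FMult F (Cod C f) (Cod C g) \<cdot>\<^bsub>D\<^esub> (FArr F f \<otimes>\<^sub>a\<^bsub>D\<^esub> FArr F g)"
    and FUnit: "is_iso D (FUnit F)" "Dom D (FUnit F) = Unit D" "Cod D (FUnit F) = FObj F (Unit C)"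
    and "\<And>X Y Z. \<lbrakk>X \<in> Obj C; Y \<in> Obj C; Z \<in> Obj C\<rbrakk> \<Longrightarrow>
       FArr F (Assoc C X Y Z) \<cdot>\<^bsub>D\<^esub> FMult F (X \<otimes>\<^bsub>C\<^esub> Y) Z
         \<cdot>\<^bsub>D\<^esub> (FMult F X Y \<otimes>\<^sub>a\<^bsub>D\<^esub> Ident D (FObj F Z))
       = FMult F X (Y \<otimes>\<^bsub>C\<^esub> Z) \<cdot>\<^bsub>D\<^esub> (Ident D (FObj F X) \<otimes>\<^sub>a\<^bsub>D\<^esub> FMult F Y Z)
         \<cdot>\<^bsub>D\<^esub> Assoc D (FObj F X) (FObj F Y) (FObj F Z)"
    and "\<And>X. X \<in> Obj C \<Longrightarrow>
       FArr F (LUnit C X) \<cdot>\<^bsub>D\<^esub> FMult F (Unit C) X \<cdot>\<^bsub>D\<^esub> (FUnit F \<otimes>\<^sub>a\<^bsub>D\<^esub> Ident D (FObj F X))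
       = LUnit D (FObj F X)"
    and "\<And>X. X \<in> Obj C \<Longrightarrow>
       FArr F (RUnit C X) \<cdot>\<^bsub>D\<^esub> FMult F X (Unit C) \<cdot>\<^bsub>D\<^esub> (Ident D (FObj F X) \<otimes>\<^sub>a\<^bsub>D\<^esub> FUnit F)
       = RUnit D (FObj F X)"
  shows "monoidal_functor C D F"
proof -
  interpret C: monoidal_category C by fact
  interpret D: monoidal_category D by fact
  interpret F: cat_functor C D F by fact
  note cat = C.category_axioms D.category_axioms
    category_prod_category[OF C.category_axioms C.category_axioms]
  have "natural_iso (prod_category C C) D
      \<lparr>FObj = (\<lambda>(X, Y). FObj F X \<otimes>\<^bsub>D\<^esub> FObj F Y), FArr = (\<lambda>(f, g). FArr F f \<otimes>\<^sub>a\<^bsub>D\<^esub> FArr F g)\<rparr>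
      (comp_functor F (tensor_functor C)) (\<lambda>(X, Y). FMult F X Y)"
    \<comment> \<open>In \<open>C\<close> interchange is used backwards: it splits a tensor product
      of composites so that functoriality of \<open>F\<close> applies.\<close>
    by (intro natural_isoI cat_functorI)
      (auto simp: cat comp_functor_def tensor_functor_def FMult nat
        simp del: C.interchange simp flip: C.interchange)
  then show ?thesis
    using assms by (intro monoidal_functor.intro monoidal_functor_axioms.intro)
      (auto simp: mem_Hom_iff is_iso_imp_Arr)
qed

lemma monoidal_functor_id_monoidal_functor:
  assumes "monoidal_category C"
  shows "monoidal_functor C C (id_monoidal_functor C)"
proof -
  interpret C: monoidal_category C by fact
  show ?thesis
    by (intro monoidal_functorI assms cat_functorI C.category_axioms)
      (simp_all add: id_monoidal_functor_def)
qed

lemma monoidal_functor_comp_monoidal_functor: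
  assumes "monoidal_functor C D F" "monoidal_functor D E G"
  shows "monoidal_functor C E (comp_monoidal_functor E G F)"
proof -
  interpret F: monoidal_functor C D F by fact
  interpret G: monoidal_functor D E G by fact
  show ?thesis
    by (intro monoidal_functorI cat_functorI F.C.monoidal_category_axioms G.D.monoidal_category_axioms
        F.C.category_axioms G.D.category_axioms)
      (simp_all add: comp_monoidal_functor_def)
qed

lemma monoidal_natural_isoI:
  assumes F: "monoidal_functor C D F" and G: "monoidal_functor C D G"
    and "\<And>X. X \<in> Obj C \<Longrightarrow> is_iso D (\<eta> X) \<and> Dom D (\<eta> X) = FObj F X \<and> Cod D (\<eta> X) = FObj G X"
    and "\<And>f. f \<in> Arr C \<Longrightarrow> FArr G f \<cdot>\<^bsub>D\<^esub> \<eta> (Dom C f) = \<eta> (Cod C f) \<cdot>\<^bsub>D\<^esub> FArr F f"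
    and "\<And>X Y. \<lbrakk>X \<in> Obj C; Y \<in> Obj C\<rbrakk> \<Longrightarrow>
       \<eta> (X \<otimes>\<^bsub>C\<^esub> Y) \<cdot>\<^bsub>D\<^esub> FMult F X Y = FMult G X Y \<cdot>\<^bsub>D\<^esub> (\<eta> X \<otimes>\<^sub>a\<^bsub>D\<^esub> \<eta> Y)"
    and "\<eta> (Unit C) \<cdot>\<^bsub>D\<^esub> FUnit F = FUnit G"
  shows "monoidal_natural_iso C D F G \<eta>"
  using assms monoidal_functor.axioms(3)[OF F] monoidal_functor.axioms(3)[OF G]
  by (intro monoidal_natural_iso.intro monoidal_natural_iso_axioms.intro natural_isoI) auto

section \<open>Weak inverses of monoidal functors\<close>

text \<open>
  The functor \<open>G\<close> is fully faithful, and \<open>\<theta> X : G (F0 X) \<rightarrow> X\<close> witnesses that it is essentially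
  surjective.
\<close>

locale monoidal_weak_equivalence =
  G: monoidal_functor D C G
  for D :: "('p, 'b, 'n) monoidal_category_scheme"
    and C :: "('o, 'a, 'm) monoidal_category_scheme"
    and G :: "('p, 'b, 'o, 'a, 'g) monoidal_functor_data_scheme" +
  fixes F0 :: "'o \<Rightarrow> 'p" and \<theta> :: "'o \<Rightarrow> 'a"
  assumes fully_faithful: "\<lbrakk>s \<in> Obj D; t \<in> Obj D\<rbrakk>
      \<Longrightarrow> bij_betw (FArr G) (Hom D s t) (Hom C (FObj G s) (FObj G t))"
    and F0_in_Obj [simp]: "X \<in> Obj C \<Longrightarrow> F0 X \<in> Obj D"
    and \<theta>_iso [simp]: "X \<in> Obj C \<Longrightarrow> is_iso C (\<theta> X)"
    and Dom_\<theta> [simp]: "X \<in> Obj C \<Longrightarrow> Dom C (\<theta> X) = FObj G (F0 X)"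
    and Cod_\<theta> [simp]: "X \<in> Obj C \<Longrightarrow> Cod C (\<theta> X) = X"
begin

lemma \<theta>_in_Arr [simp]: "X \<in> Obj C \<Longrightarrow> \<theta> X \<in> Arr C"
  by (simp add: is_iso_imp_Arr)

text \<open>Transfers an equation in \<open>D\<close> to its image in \<open>C\<close>, where the
  rules for \<open>FArr G\<close> compute both sides.\<close>

lemma faithful:
  assumes "a \<in> Arr D" "b \<in> Arr D" "Dom D a = Dom D b" "Cod D a = Cod D b" "FArr G a = FArr G b"
  shows "a = b"
  using bij_betw_imp_inj_on[OF fully_faithful, of "Dom D a" "Cod D a"] assms
  by (auto simp: inj_on_def mem_Hom_iff)

text \<open>Both endpoints are arguments because \<open>G\<close> may identify objects, so an arrow
  of \<open>C\<close> alone does not determine the hom-set into which it is lifted.\<close>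

definition lift :: "'p \<Rightarrow> 'p \<Rightarrow> 'a \<Rightarrow> 'b" where
  "lift X Y = the_inv_into (Hom D X Y) (FArr G)"

lemma lift_simps [simp]:
  assumes "X \<in> Obj D" "Y \<in> Obj D" "f \<in> Arr C" "Dom C f = FObj G X" "Cod C f = FObj G Y"
  shows "lift X Y f \<in> Arr D" "Dom D (lift X Y f) = X" "Cod D (lift X Y f) = Y"
    "FArr G (lift X Y f) = f"
proof -
  note bij = fully_faithful[OF assms(1,2)]
  have f: "f \<in> Hom C (FObj G X) (FObj G Y)"
    using assms by (simp add: mem_Hom_iff)
  have "lift X Y f \<in> Hom D X Y"
    unfolding lift_def using bij_betw_apply[OF bij_betw_the_inv_into[OF bij] f] .
  then show "lift X Y f \<in> Arr D" "Dom D (lift X Y f) = X" "Cod D (lift X Y f) = Y"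
    by (simp_all add: mem_Hom_iff)
  show "FArr G (lift X Y f) = f"
    unfolding lift_def using f_the_inv_into_f_bij_betw[OF bij] f by blast
qed

text \<open>Fully faithful functors reflect isomorphisms: the lift of the inverse is inverse to the
  lift.\<close>

lemma is_iso_lift [simp]:
  assumes "X \<in> Obj D" "Y \<in> Obj D" "is_iso C f" "Dom C f = FObj G X" "Cod C f = FObj G Y"
  shows "is_iso D (lift X Y f)"
proof (rule G.C.is_isoI[where g = "lift Y X (Inv C f)"])
  note [simp] = is_iso_imp_Arr[OF assms(3)]
  show "lift Y X (Inv C f) \<cdot>\<^bsub>D\<^esub> lift X Y f = Ident D (Dom D (lift X Y f))"
    "lift X Y f \<cdot>\<^bsub>D\<^esub> lift Y X (Inv C f) = Ident D (Cod D (lift X Y f))"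
    by (rule faithful; use assms in simp)+
qed (use assms is_iso_imp_Arr[OF assms(3)] in simp_all)

text \<open>
  Every component is the unique one making \<open>\<theta>\<close> a monoidal natural isomorphism from \<open>G \<circ> F\<close> to the
  identity.
\<close>

definition weak_inverse :: "('o, 'a, 'p, 'b) monoidal_functor_data" where
  "weak_inverse =
     \<lparr>FObj = F0,
      FArr = (\<lambda>f. lift (F0 (Dom C f)) (F0 (Cod C f)) (Inv C (\<theta> (Cod C f)) \<cdot>\<^bsub>C\<^esub> (f \<cdot>\<^bsub>C\<^esub> \<theta> (Dom C f)))),
      FMult = (\<lambda>X Y. lift (F0 X \<otimes>\<^bsub>D\<^esub> F0 Y) (F0 (X \<otimes>\<^bsub>C\<^esub> Y))
        (Inv C (\<theta> (X \<otimes>\<^bsub>C\<^esub> Y)) \<cdot>\<^bsub>C\<^esub> ((\<theta> X \<otimes>\<^sub>a\<^bsub>C\<^esub> \<theta> Y) \<cdot>\<^bsub>C\<^esub> Inv C (FMult G (F0 X) (F0 Y))))),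
      FUnit = lift (Unit D) (F0 (Unit C)) (Inv C (\<theta> (Unit C)) \<cdot>\<^bsub>C\<^esub> Inv C (FUnit G))\<rparr>"

lemma monoidal_functor_weak_inverse: "monoidal_functor C D weak_inverse"
proof (rule monoidal_functorI)
  show "cat_functor C D weak_inverse"
  proof (rule cat_functorI)
    fix X assume "X \<in> Obj C"
    then show "FArr weak_inverse (Ident C X) = Ident D (FObj weak_inverse X)"
      by (intro faithful) (simp_all add: weak_inverse_def)
  next
    fix f g assume "f \<in> Arr C" "g \<in> Arr C" "Dom C g = Cod C f"
    then show "FArr weak_inverse (g \<cdot>\<^bsub>C\<^esub> f) = FArr weak_inverse g \<cdot>\<^bsub>D\<^esub> FArr weak_inverse f"
      by (intro faithful) (simp_all add: weak_inverse_def)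
  qed (simp_all add: weak_inverse_def G.C.category_axioms G.D.category_axioms)
next
  fix f g assume "f \<in> Arr C" "g \<in> Arr C"
  then show "FArr weak_inverse (f \<otimes>\<^sub>a\<^bsub>C\<^esub> g) \<cdot>\<^bsub>D\<^esub> FMult weak_inverse (Dom C f) (Dom C g)
      = FMult weak_inverse (Cod C f) (Cod C g) \<cdot>\<^bsub>D\<^esub> (FArr weak_inverse f \<otimes>\<^sub>a\<^bsub>D\<^esub> FArr weak_inverse g)"
    by (intro faithful) (simp_all add: weak_inverse_def)
next
  fix X Y Z assume "X \<in> Obj C" "Y \<in> Obj C" "Z \<in> Obj C"
  then show "FArr weak_inverse (Assoc C X Y Z) \<cdot>\<^bsub>D\<^esub> FMult weak_inverse (X \<otimes>\<^bsub>C\<^esub> Y) Z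
         \<cdot>\<^bsub>D\<^esub> (FMult weak_inverse X Y \<otimes>\<^sub>a\<^bsub>D\<^esub> Ident D (FObj weak_inverse Z))
       = FMult weak_inverse X (Y \<otimes>\<^bsub>C\<^esub> Z) \<cdot>\<^bsub>D\<^esub> (Ident D (FObj weak_inverse X) \<otimes>\<^sub>a\<^bsub>D\<^esub> FMult weak_inverse Y Z)
         \<cdot>\<^bsub>D\<^esub> Assoc D (FObj weak_inverse X) (FObj weak_inverse Y) (FObj weak_inverse Z)"
    by (intro faithful) (simp_all add: weak_inverse_def)
next
  fix X assume X [simp]: "X \<in> Obj C"
  show "FArr weak_inverse (LUnit C X) \<cdot>\<^bsub>D\<^esub> FMult weak_inverse (Unit C) X
      \<cdot>\<^bsub>D\<^esub> (FUnit weak_inverse \<otimes>\<^sub>a\<^bsub>D\<^esub> Ident D (FObj weak_inverse X))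
    = LUnit D (FObj weak_inverse X)"
    \<comment> \<open>Under \<open>G\<close> the left side ends in the unitor after
      \<open>Inv C (FUnit G)\<close> tensored with \<open>\<theta> X\<close>. Sliding
      \<open>\<theta> X\<close> through the unitor lets it cancel against
      \<open>Inv C (\<theta> X)\<close>.\<close>
    using G.D.LUnit_TensorA[of "\<theta> X" "Inv C (FUnit G)"]
    by (intro faithful) (simp_all add: weak_inverse_def)
  show "FArr weak_inverse (RUnit C X) \<cdot>\<^bsub>D\<^esub> FMult weak_inverse X (Unit C)
      \<cdot>\<^bsub>D\<^esub> (Ident D (FObj weak_inverse X) \<otimes>\<^sub>a\<^bsub>D\<^esub> FUnit weak_inverse)
    = RUnit D (FObj weak_inverse X)"
    using G.D.RUnit_TensorA[of "\<theta> X" "Inv C (FUnit G)"]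
    by (intro faithful) (simp_all add: weak_inverse_def)
qed (simp_all add: weak_inverse_def G.C.monoidal_category_axioms G.D.monoidal_category_axioms)

text \<open>Since \<open>\<theta>\<close> runs from \<open>G \<circ> F\<close> to the identity, its
  inverse is the unit; the counit at \<open>s\<close> is the arrow of \<open>D\<close> whose image
  under \<open>G\<close> is \<open>\<theta>\<close> at \<open>FObj G s\<close>.\<close>

lemma monoidal_equivalence_weak_inverse:
  "monoidal_equivalence C D weak_inverse G (\<lambda>X. Inv C (\<theta> X))
     (\<lambda>s. lift (F0 (FObj G s)) s (\<theta> (FObj G s)))"
proof (intro monoidal_equivalence.intro)
  note F = monoidal_functor_weak_inverse and G = G.monoidal_functor_axioms
  note defs = weak_inverse_def comp_monoidal_functor_def id_monoidal_functor_def
  show "monoidal_functor C D weak_inverse" "monoidal_functor D C G"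
    by (fact F G)+
  show "monoidal_natural_iso C C (id_monoidal_functor C) (comp_monoidal_functor C G weak_inverse)
      (\<lambda>X. Inv C (\<theta> X))"
    by (intro monoidal_natural_isoI monoidal_functor_id_monoidal_functor G.D.monoidal_category_axioms
        monoidal_functor_comp_monoidal_functor[OF F G]) (simp_all add: defs)
  show "monoidal_natural_iso D D (comp_monoidal_functor D weak_inverse G) (id_monoidal_functor D)
      (\<lambda>s. lift (F0 (FObj G s)) s (\<theta> (FObj G s)))"
    \<comment> \<open>The equations for the counit lie in \<open>D\<close>, so here the simplifier
      also needs \<open>faithful\<close> to pass to their images.\<close>
    by (intro monoidal_natural_isoI monoidal_functor_id_monoidal_functor G.C.monoidal_category_axioms
        monoidal_functor_comp_monoidal_functor[OF G F]) (simp_all add: defs faithful)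
qed

end

section \<open>The strictification\<close>

text \<open>If the tensor product is strictly associative and unital on objects and on arrows,
  identities serve as constraints: the laws on arrows are their naturality, and pentagon and
  triangle relate identities only.\<close>

lemma strict_monoidal_categoryI:
  fixes C (structure)
  assumes "category C"
    and [simp]: "\<And>X Y. \<lbrakk>X \<in> Obj C; Y \<in> Obj C\<rbrakk> \<Longrightarrow> X \<otimes> Y \<in> Obj C"
    and [simp]: "\<And>f g. \<lbrakk>f \<in> Arr C; g \<in> Arr C\<rbrakk> \<Longrightarrow> f \<otimes>\<^sub>a g \<in> Arr C"
    and [simp]: "\<And>f g. \<lbrakk>f \<in> Arr C; g \<in> Arr C\<rbrakk> \<Longrightarrow> Dom C (f \<otimes>\<^sub>a g) = Dom C f \<otimes> Dom C g"
    and [simp]: "\<And>f g. \<lbrakk>f \<in> Arr C; g \<in> Arr C\<rbrakk> \<Longrightarrow> Cod C (f \<otimes>\<^sub>a g) = Cod C f \<otimes> Cod C g"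
    and [simp]: "\<And>X Y. \<lbrakk>X \<in> Obj C; Y \<in> Obj C\<rbrakk> \<Longrightarrow> Ident C X \<otimes>\<^sub>a Ident C Y = Ident C (X \<otimes> Y)"
    and [simp]: "\<And>f g f' g'. \<lbrakk>f \<in> Arr C; g \<in> Arr C; f' \<in> Arr C; g' \<in> Arr C;
           Dom C f' = Cod C f; Dom C g' = Cod C g\<rbrakk>
           \<Longrightarrow> (f' \<cdot> f) \<otimes>\<^sub>a (g' \<cdot> g) = (f' \<otimes>\<^sub>a g') \<cdot> (f \<otimes>\<^sub>a g)"
    and [simp]: "Unit C \<in> Obj C"
    and [simp]: "\<And>X Y Z. \<lbrakk>X \<in> Obj C; Y \<in> Obj C; Z \<in> Obj C\<rbrakk> \<Longrightarrow> (X \<otimes> Y) \<otimes> Z = X \<otimes> (Y \<otimes> Z)"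
    and [simp]: "\<And>f g h. \<lbrakk>f \<in> Arr C; g \<in> Arr C; h \<in> Arr C\<rbrakk> \<Longrightarrow> (f \<otimes>\<^sub>a g) \<otimes>\<^sub>a h = f \<otimes>\<^sub>a (g \<otimes>\<^sub>a h)"
    and [simp]: "\<And>X. X \<in> Obj C \<Longrightarrow> Unit C \<otimes> X = X" "\<And>X. X \<in> Obj C \<Longrightarrow> X \<otimes> Unit C = X"
    and [simp]: "\<And>f. f \<in> Arr C \<Longrightarrow> Ident C (Unit C) \<otimes>\<^sub>a f = f"
      "\<And>f. f \<in> Arr C \<Longrightarrow> f \<otimes>\<^sub>a Ident C (Unit C) = f"
    and [simp]: "\<And>X Y Z. \<lbrakk>X \<in> Obj C; Y \<in> Obj C; Z \<in> Obj C\<rbrakk> \<Longrightarrow> Assoc C X Y Z = Ident C (X \<otimes> (Y \<otimes> Z))"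
    and [simp]: "\<And>X. X \<in> Obj C \<Longrightarrow> LUnit C X = Ident C X" "\<And>X. X \<in> Obj C \<Longrightarrow> RUnit C X = Ident C X"
  shows "strict_monoidal_category C"
proof -
  interpret category C by fact
  note cat = \<open>category C\<close> category_prod_category[OF \<open>category C\<close>]
  show ?thesis
  proof (intro strict_monoidal_category.intro strict_monoidal_category_axioms.intro
      monoidal_category.intro monoidal_category_axioms.intro)
    show "cat_functor (prod_category C C) C (tensor_functor C)"
      by (rule cat_functorI) (auto simp: cat tensor_functor_def)
    show "natural_iso (prod_category C (prod_category C C)) C
         \<lparr>FObj = (\<lambda>(X, Y, Z). (X \<otimes> Y) \<otimes> Z), FArr = (\<lambda>(f, g, h). (f \<otimes>\<^sub>a g) \<otimes>\<^sub>a h)\<rparr>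
         \<lparr>FObj = (\<lambda>(X, Y, Z). X \<otimes> (Y \<otimes> Z)), FArr = (\<lambda>(f, g, h). f \<otimes>\<^sub>a (g \<otimes>\<^sub>a h))\<rparr>
         (\<lambda>(X, Y, Z). Assoc C X Y Z)"
      by (intro natural_isoI cat_functorI) (auto simp: cat)
    show "natural_iso C C
         \<lparr>FObj = (\<lambda>X. Unit C \<otimes> X), FArr = (\<lambda>f. Ident C (Unit C) \<otimes>\<^sub>a f)\<rparr> id_functor (LUnit C)"
      by (intro natural_isoI cat_functorI) (auto simp: cat id_functor_def)
    show "natural_iso C C
         \<lparr>FObj = (\<lambda>X. X \<otimes> Unit C), FArr = (\<lambda>f. f \<otimes>\<^sub>a Ident C (Unit C))\<rparr> id_functor (RUnit C)"
      by (intro natural_isoI cat_functorI) (auto simp: cat id_functor_def)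
  qed (simp_all add: cat)
qed

context monoidal_category
begin

section \<open>Evaluation of lists and its canonical isomorphisms\<close>

primrec tensor_list :: "'o list \<Rightarrow> 'o" where
  "tensor_list [] = Unit C"
| "tensor_list (X # s) = X \<otimes> tensor_list s"

text \<open>Reassociate to free the head \<open>X\<close>, then recurse under the tensor product
  with \<open>X\<close>; the unit that ends the first product is absorbed by the left
  unitor.\<close>

primrec tensor_append :: "'o list \<Rightarrow> 'o list \<Rightarrow> 'a" where
  "tensor_append [] t = LUnit C (tensor_list t)"
| "tensor_append (X # s) t =
     (Ident C X \<otimes>\<^sub>a tensor_append s t) \<cdot> Assoc C X (tensor_list s) (tensor_list t)"

lemma tensor_list_in_Obj [simp]: "s \<in> lists (Obj C) \<Longrightarrow> tensor_list s \<in> Obj C"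
  by (induction s) auto

lemma tensor_append_simps [simp]:
  assumes "s \<in> lists (Obj C)" "t \<in> lists (Obj C)"
  shows "is_iso C (tensor_append s t)" "tensor_append s t \<in> Arr C"
    "Dom C (tensor_append s t) = tensor_list s \<otimes> tensor_list t"
    "Cod C (tensor_append s t) = tensor_list (s @ t)"
  using assms by (induction s) auto

text \<open>The base case is the equality of the two unitors at the unit, the induction step the law
  for the right unitor of a product.\<close>

lemma tensor_append_Nil_right:
  "s \<in> lists (Obj C) \<Longrightarrow> tensor_append s [] = RUnit C (tensor_list s)"
  by (induction s) (auto simp: LUnit_Unit RUnit_TensorO)

text \<open>
  This is both the hexagon for the functor \<open>s \<mapsto> tensor_list s\<close> and the reason why the tensor product
  of arrows of the strictification is strictly associative.
\<close>

lemma tensor_append_append: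
  assumes "s \<in> lists (Obj C)" and [simp]: "t \<in> lists (Obj C)" "u \<in> lists (Obj C)"
  shows "tensor_append (s @ t) u \<cdot> (tensor_append s t \<otimes>\<^sub>a Ident C (tensor_list u))
         = tensor_append s (t @ u) \<cdot> ((Ident C (tensor_list s) \<otimes>\<^sub>a tensor_append t u)
           \<cdot> Assoc C (tensor_list s) (tensor_list t) (tensor_list u))"
  using assms(1)
proof (induction s)
  case Nil
  \<comment> \<open>For the empty list the claim is naturality of the left unitor at
    \<open>tensor_append t u\<close>, combined with its law for products.\<close>
  have "LUnit C (tensor_list (t @ u)) \<cdot> ((Ident C (Unit C) \<otimes>\<^sub>a tensor_append t u)
          \<cdot> Assoc C (Unit C) (tensor_list t) (tensor_list u))
      = (LUnit C (tensor_list (t @ u)) \<cdot> (Ident C (Unit C) \<otimes>\<^sub>a tensor_append t u))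
          \<cdot> Assoc C (Unit C) (tensor_list t) (tensor_list u)"
    by simp
  also have "\<dots> = (tensor_append t u \<cdot> LUnit C (tensor_list t \<otimes> tensor_list u))
          \<cdot> Assoc C (Unit C) (tensor_list t) (tensor_list u)"
    using LUnit_naturality[of "tensor_append t u"] by simp
  also have "\<dots> = tensor_append t u \<cdot> (LUnit C (tensor_list t) \<otimes>\<^sub>a Ident C (tensor_list u))"
    by (simp add: LUnit_TensorO)
  finally show ?case
    by simp
next
  case (Cons X s)
  then have [simp]: "X \<in> Obj C" "s \<in> lists (Obj C)"
    by auto
  let ?X = "Ident C X" and ?s = "tensor_list s" and ?t = "tensor_list t" and ?u = "tensor_list u"
  \<comment> \<open>The associators produced by unfolding at the head \<open>X\<close>. The
    induction hypothesis adds one more under \<open>X\<close>, which completes the longer side of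
    the pentagon for \<open>X\<close>, \<open>?s\<close>, \<open>?t\<close>,
    \<open>?u\<close>.\<close>
  let ?\<alpha> = "Assoc C X (?s \<otimes> ?t) ?u \<cdot> (Assoc C X ?s ?t \<otimes>\<^sub>a Ident C ?u)"
  have "tensor_append ((X # s) @ t) u \<cdot> (tensor_append (X # s) t \<otimes>\<^sub>a Ident C ?u)
      = (?X \<otimes>\<^sub>a tensor_append (s @ t) u) \<cdot> ((?X \<otimes>\<^sub>a (tensor_append s t \<otimes>\<^sub>a Ident C ?u)) \<cdot> ?\<alpha>)"
    by simp
  also have "\<dots> = (?X \<otimes>\<^sub>a (tensor_append (s @ t) u \<cdot> (tensor_append s t \<otimes>\<^sub>a Ident C ?u))) \<cdot> ?\<alpha>"
    by (subst interchange_Comp) simp_all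
  also have "\<dots> = (?X \<otimes>\<^sub>a (tensor_append s (t @ u) \<cdot> ((Ident C ?s \<otimes>\<^sub>a tensor_append t u)
      \<cdot> Assoc C ?s ?t ?u))) \<cdot> ?\<alpha>"
    by (subst Cons.IH) simp_all
  also have "\<dots> = (?X \<otimes>\<^sub>a tensor_append s (t @ u)) \<cdot> ((?X \<otimes>\<^sub>a (Ident C ?s \<otimes>\<^sub>a tensor_append t u)) \<cdot>
      ((?X \<otimes>\<^sub>a Assoc C ?s ?t ?u) \<cdot> Assoc C X (?s \<otimes> ?t) ?u \<cdot> (Assoc C X ?s ?t \<otimes>\<^sub>a Ident C ?u)))"
    by simp
  also have "\<dots> = (?X \<otimes>\<^sub>a tensor_append s (t @ u)) \<cdot> ((?X \<otimes>\<^sub>a (Ident C ?s \<otimes>\<^sub>a tensor_append t u)) \<cdot>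
      (Assoc C X ?s (?t \<otimes> ?u) \<cdot> Assoc C (X \<otimes> ?s) ?t ?u))"
    by (subst pentagon) simp_all
  finally show ?case
    by simp
qed

text \<open>
  The tensor product of arrows is transported along \<open>tensor_append\<close>, so that \<open>tensor_append\<close> becomes
  natural.
\<close>

definition strictification :: "('o list, 'o list \<times> 'a \<times> 'o list) monoidal_category" where
  "strictification =
     \<lparr>Obj = lists (Obj C),
      Arr = {(s, f, t). s \<in> lists (Obj C) \<and> t \<in> lists (Obj C) \<and>
               f \<in> Hom C (tensor_list s) (tensor_list t)},
      Dom = (\<lambda>(s, f, t). s),
      Cod = (\<lambda>(s, f, t). t),
      Ident = (\<lambda>s. (s, Ident C (tensor_list s), s)),
      Comp = (\<lambda>(_, g, u) (s, f, _). (s, g \<cdot> f, u)),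
      TensorO = (@),
      TensorA = (\<lambda>(s, f, s') (t, g, t').
        (s @ t, tensor_append s' t' \<cdot> ((f \<otimes>\<^sub>a g) \<cdot> Inv C (tensor_append s t)), s' @ t')),
      Unit = [],
      Assoc = (\<lambda>s t u. (s @ t @ u, Ident C (tensor_list (s @ t @ u)), s @ t @ u)),
      LUnit = (\<lambda>s. (s, Ident C (tensor_list s), s)),
      RUnit = (\<lambda>s. (s, Ident C (tensor_list s), s))\<rparr>"

lemma category_strictification: "category strictification"
  by unfold_locales (auto simp: strictification_def mem_Hom_iff)

text \<open>On objects the tensor product is concatenation, so the real work is strict associativity
  and unitality on arrows, where \<open>tensor_append\<close> enters.\<close>

lemma strict_monoidal_category_strictification: "strict_monoidal_category strictification"
proof (rule strict_monoidal_categoryI)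
  fix a b c
  assume Arr: "a \<in> Arr strictification" "b \<in> Arr strictification" "c \<in> Arr strictification"
  obtain s f s' t g t' u h u' where abc: "a = (s, f, s')" "b = (t, g, t')" "c = (u, h, u')"
    by (metis prod_cases3)
  with Arr have [simp]: "s \<in> lists (Obj C)" "s' \<in> lists (Obj C)" "t \<in> lists (Obj C)"
      "t' \<in> lists (Obj C)" "u \<in> lists (Obj C)" "u' \<in> lists (Obj C)"
      "f \<in> Arr C" "g \<in> Arr C" "h \<in> Arr C"
      "Dom C f = tensor_list s" "Cod C f = tensor_list s'"
      "Dom C g = tensor_list t" "Cod C g = tensor_list t'"
      "Dom C h = tensor_list u" "Cod C h = tensor_list u'"
    by (simp_all add: strictification_def mem_Hom_iff)
  \<comment> \<open>\<open>?L\<close> and \<open>?R\<close> are the underlying arrows of the two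
    bracketings of the tensor product of \<open>a\<close>, \<open>b\<close>,
    \<open>c\<close>.\<close>
  let ?L = "tensor_append (s' @ t') u' \<cdot>
    (((tensor_append s' t' \<cdot> ((f \<otimes>\<^sub>a g) \<cdot> Inv C (tensor_append s t))) \<otimes>\<^sub>a h)
      \<cdot> Inv C (tensor_append (s @ t) u))"
  let ?R = "tensor_append s' (t' @ u') \<cdot>
    ((f \<otimes>\<^sub>a (tensor_append t' u' \<cdot> ((g \<otimes>\<^sub>a h) \<cdot> Inv C (tensor_append t u))))
      \<cdot> Inv C (tensor_append s (t @ u)))"
  \<comment> \<open>Precomposing with \<open>?J\<close> removes the inverses: from \<open>?L\<close>
    directly, from \<open>?R\<close> after coherence for \<open>s\<close>, \<open>t\<close>,
    \<open>u\<close> rewrites \<open>?J\<close>.\<close>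
  let ?J = "tensor_append (s @ t) u \<cdot> (tensor_append s t \<otimes>\<^sub>a Ident C (tensor_list u))"
  let ?\<alpha> = "Assoc C (tensor_list s') (tensor_list t') (tensor_list u')"
  have "?R \<cdot> ?J = tensor_append s' (t' @ u') \<cdot> ((f \<otimes>\<^sub>a (tensor_append t' u' \<cdot> (g \<otimes>\<^sub>a h)))
      \<cdot> Assoc C (tensor_list s) (tensor_list t) (tensor_list u))"
    by (subst tensor_append_append) simp_all
  also have "\<dots> = tensor_append s' (t' @ u') \<cdot> ((Ident C (tensor_list s') \<otimes>\<^sub>a tensor_append t' u')
      \<cdot> ((f \<otimes>\<^sub>a (g \<otimes>\<^sub>a h)) \<cdot> Assoc C (tensor_list s) (tensor_list t) (tensor_list u)))"
    by (subst interchange_Comp) simp_all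
  \<comment> \<open>Naturality moves the associator to the codomain side, where coherence applies
    once more, now to \<open>s'\<close>, \<open>t'\<close>, \<open>u'\<close>.\<close>
  also have "\<dots> = (tensor_append s' (t' @ u') \<cdot> ((Ident C (tensor_list s') \<otimes>\<^sub>a tensor_append t' u')
      \<cdot> ?\<alpha>)) \<cdot> ((f \<otimes>\<^sub>a g) \<otimes>\<^sub>a h)"
    by simp
  also have "\<dots> = (tensor_append (s' @ t') u' \<cdot>
      (tensor_append s' t' \<otimes>\<^sub>a Ident C (tensor_list u'))) \<cdot> ((f \<otimes>\<^sub>a g) \<otimes>\<^sub>a h)"
    by (subst tensor_append_append) simp_all
  also have "\<dots> = ?L \<cdot> ?J"
    by simp
  finally have "?L = ?R"
    by (rule iso_cancel_right[rotated -1, OF sym]) simp_all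
  then show "(a \<otimes>\<^sub>a\<^bsub>strictification\<^esub> b) \<otimes>\<^sub>a\<^bsub>strictification\<^esub> c
      = a \<otimes>\<^sub>a\<^bsub>strictification\<^esub> (b \<otimes>\<^sub>a\<^bsub>strictification\<^esub> c)"
    by (simp add: abc strictification_def)
next
  fix a
  assume "a \<in> Arr strictification"
  then obtain s f s' where a: "a = (s, f, s')"
    and [simp]: "s \<in> lists (Obj C)" "s' \<in> lists (Obj C)" "f \<in> Arr C"
      "Dom C f = tensor_list s" "Cod C f = tensor_list s'"
    by (auto simp: strictification_def mem_Hom_iff)
  \<comment> \<open>Tensoring with the identity of \<open>[]\<close> conjugates by unitors, because
    \<open>tensor_append [] s\<close> is one; naturality then gives back \<open>f\<close>.\<close>
  have "LUnit C (tensor_list s') \<cdot> ((Ident C (Unit C) \<otimes>\<^sub>a f) \<cdot> Inv C (LUnit C (tensor_list s)))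
      = (f \<cdot> LUnit C (tensor_list s)) \<cdot> Inv C (LUnit C (tensor_list s))"
    using LUnit_naturality[of f] by (subst Comp_assoc'[symmetric]) simp_all
  then show "Ident strictification (Unit strictification) \<otimes>\<^sub>a\<^bsub>strictification\<^esub> a = a"
    by (simp add: a strictification_def)
  have "RUnit C (tensor_list s') \<cdot> ((f \<otimes>\<^sub>a Ident C (Unit C)) \<cdot> Inv C (RUnit C (tensor_list s)))
      = (f \<cdot> RUnit C (tensor_list s)) \<cdot> Inv C (RUnit C (tensor_list s))"
    using RUnit_naturality[of f] by (subst Comp_assoc'[symmetric]) simp_all
  then show "a \<otimes>\<^sub>a\<^bsub>strictification\<^esub> Ident strictification (Unit strictification) = a"
    by (simp add: a strictification_def tensor_append_Nil_right)
qed (rule category_strictification, auto simp: strictification_def mem_Hom_iff in_lists_conv_set)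

section \<open>The evaluation functor\<close>

definition strictification_functor :: "('o list, 'o list \<times> 'a \<times> 'o list, 'o, 'a) monoidal_functor_data"
where
  "strictification_functor =
     \<lparr>FObj = tensor_list, FArr = (\<lambda>(s, f, t). f), FMult = tensor_append, FUnit = Ident C (Unit C)\<rparr>"

text \<open>Naturality of \<open>FMult\<close> is built into \<open>TensorA\<close>. As the
  constraints of the source are identities, the hexagon is \<open>tensor_append_append\<close>, and
  the right unit square is \<open>tensor_append_Nil_right\<close>.\<close>

lemma monoidal_functor_strictification_functor:
  "monoidal_functor strictification C strictification_functor"
proof (rule monoidal_functorI)
  show "cat_functor strictification C strictification_functor"
    by (rule cat_functorI)
      (rule category_strictification category_axioms
        | auto simp: strictification_def strictification_functor_def mem_Hom_iff in_lists_conv_set)+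
  show "monoidal_category strictification"
    using strict_monoidal_category_strictification by (rule strict_monoidal_category.axioms)
next
  fix s t u
  assume "s \<in> Obj strictification" "t \<in> Obj strictification" "u \<in> Obj strictification"
  then have "s \<in> lists (Obj C)" "t \<in> lists (Obj C)" "u \<in> lists (Obj C)"
    by (simp_all add: strictification_def)
  then show "FArr strictification_functor (Assoc strictification s t u)
      \<cdot> FMult strictification_functor (s \<otimes>\<^bsub>strictification\<^esub> t) u
      \<cdot> (FMult strictification_functor s t \<otimes>\<^sub>a Ident C (FObj strictification_functor u))
    = FMult strictification_functor s (t \<otimes>\<^bsub>strictification\<^esub> u)
      \<cdot> (Ident C (FObj strictification_functor s) \<otimes>\<^sub>a FMult strictification_functor t u)
      \<cdot> Assoc C (FObj strictification_functor s) (FObj strictification_functor t)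
          (FObj strictification_functor u)"
    using tensor_append_append[of s t u]
    by (simp add: strictification_def strictification_functor_def)
qed (auto simp: strictification_def strictification_functor_def mem_Hom_iff in_lists_conv_set
    monoidal_category_axioms tensor_append_Nil_right)

text \<open>An arrow of the strictification is an arrow of \<open>C\<close> tagged with two lists,
  since the evaluations do not determine the lists. On a fixed hom-set, removing the tags is a
  bijection.\<close>

lemma monoidal_weak_equivalence_strictification_functor:
  "monoidal_weak_equivalence strictification C strictification_functor (\<lambda>X. [X]) (RUnit C)"
proof (intro monoidal_weak_equivalence.intro monoidal_weak_equivalence_axioms.intro)
  fix s t
  assume "s \<in> Obj strictification" "t \<in> Obj strictification"
  then show "bij_betw (FArr strictification_functor) (Hom strictification s t)
      (Hom C (FObj strictification_functor s) (FObj strictification_functor t))"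
    by (intro bij_betw_byWitness[where f' = "\<lambda>f. (s, f, t)"])
      (auto simp: strictification_def strictification_functor_def mem_Hom_iff)
qed (rule monoidal_functor_strictification_functor,
    simp_all add: strictification_def strictification_functor_def)

end

theorem theorem3p17:
  fixes C :: "('o, 'a) monoidal_category"
  assumes "monoidal_category C"
  shows "\<exists>D :: ('o list, 'o list \<times> 'a \<times> 'o list) monoidal_category.
           strict_monoidal_category D \<and> monoidally_equivalent C D"
proof -
  interpret monoidal_category C by fact
  \<comment> \<open>Evaluation runs from the strictification to \<open>C\<close>; its weak inverse
    provides the functor out of \<open>C\<close>.\<close>
  interpret monoidal_weak_equivalence strictification C strictification_functor "\<lambda>X. [X]" "RUnit C"
    by (rule monoidal_weak_equivalence_strictification_functor)
  have "\<exists>G :: ('o list, 'o list \<times> 'a \<times> 'o list, 'o, 'a) monoidal_functor_data.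
      \<exists>\<eta> \<epsilon>. monoidal_equivalence C strictification weak_inverse G \<eta> \<epsilon>"
    using monoidal_equivalence_weak_inverse by blast
  then have "monoidally_equivalent C strictification"
    unfolding monoidally_equivalent_def by blast
  then show ?thesis
    using strict_monoidal_category_strictification by blast
qed

end
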